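(* Let $-\infty\le a<b\le\infty$. The regression function $y\mapsto\mathbb{E}(X_{1:2}\mid X_{2:2}^{(1)}=y)$, $y\in(a,b)$ (alternatively, $y\mapsto\mathbb{E}(X_{2:2}\mid X_{1:2}^{(1)}=y)$, $y\in(a,b)$) determines uniquely the parent distribution among absolutely continuous distributions with interval support $(a,b)$ if $(a,b)\subsetneq\mathbb{R}$; if $(a,b)=\mathbb{R}$ it determines the distribution up to a shift. That is: let $F$ and $G$ be the cumulative distribution functions of two absolutely continuous distributions with support the interval $(a,b)$, such that $X_{1:2}$ is integrable under both $F$ and $G$, and suppose that $\mathbb{E}(X_{1:2}\mid X_{2:2}^{(1)}=y)$ is the same function of $y\in(a,b)$ when the parent distribution is $F$ and when it is $G$. Then $F=G$ if $(a,b)\ne\mathbb{R}$, and there is a constant $c\in\mathbb{R}$ with $G(y)=F(y+c)$ for all $y\in\mathbb{R}$ if $(a,b)=\mathbb{R}$. The same holds with $X_{1:2}$ and $X_{2:2}^{(1)}$ replaced by $X_{2:2}$ and $X_{1:2}^{(1)}$ respectively.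
   Context: $X_1,X_2,X_3$ are independent identically distributed real random variables with the parent distribution, which is absolutely continuous with respect to Lebesgue measure. $X_{1:2}=\min(X_1,X_2)$, $X_{2:2}=\max(X_1,X_2)$, $X_{1:2}^{(1)}=\min(X_2,X_3)$, $X_{2:2}^{(1)}=\max(X_2,X_3)$. A distribution with interval support $(a,b)$ has a cumulative distribution function which is strictly increasing on $(a,b)$, with value $0$ at the left end and $1$ at the right end. The regression functions are understood as their continuous versions on $(a,b)$. *)

theory Defs
  imports "HOL-Probability.Probability"
begin

definition iid_triple :: "'a measure \<Rightarrow> (nat \<Rightarrow> 'a \<Rightarrow> real) \<Rightarrow> real measure \<Rightarrow> bool" where
  "iid_triple M X \<mu> \<longleftrightarrow>
     prob_space M \<and>
     prob_space.indep_vars M (\<lambda>_. borel) X {1, 2, 3} \<and>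
     (\<forall>i\<in>{1, 2, 3}. distr M borel (X i) = \<mu>)"

text \<open>
  The boundary conditions on the distribution function only say something at finite end points;
  at \<open>a = -\<infinity>\<close> and at \<open>b = \<infinity>\<close> the limits \<open>0\<close> and \<open>1\<close> hold for the distribution function of
  every probability measure on the reals.
\<close>
definition interval_support :: "real measure \<Rightarrow> ereal \<Rightarrow> ereal \<Rightarrow> bool" where
  "interval_support \<mu> a b \<longleftrightarrow>
     strict_mono_on (einterval a b) (cdf \<mu>) \<and>
     (\<forall>x. ereal x \<le> a \<longrightarrow> cdf \<mu> x = 0) \<and>
     (\<forall>x. b \<le> ereal x \<longrightarrow> cdf \<mu> x = 1)"

text \<open>
  \<open>r\<close> is the continuous version on \<open>(a, b)\<close> of \<open>y \<mapsto> E(Z | Y = y)\<close>. It is meant for \<open>Y\<close> with values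
  almost surely in \<open>(a, b)\<close>; the values of \<open>r\<close> outside \<open>(a, b)\<close> are then irrelevant.
\<close>
definition continuous_regression ::
  "'a measure \<Rightarrow> ('a \<Rightarrow> real) \<Rightarrow> ('a \<Rightarrow> real) \<Rightarrow> ereal \<Rightarrow> ereal \<Rightarrow> (real \<Rightarrow> real) \<Rightarrow> bool" where
  "continuous_regression M Z Y a b r \<longleftrightarrow>
     continuous_on (einterval a b) r \<and>
     (AE \<omega> in M. real_cond_exp M (vimage_algebra (space M) Y borel) Z \<omega> = r (Y \<omega>))"

end

theory Submission imports Defs begin

text \<open>
  Let \<open>F\<close> be the distribution function, \<open>m y = E (min X y)\<close> and \<open>K y = E (m X; X \<le> y)\<close>. Given
  \<open>max X\<^sub>2 X\<^sub>3 = y\<close>, either of \<open>X\<^sub>2\<close> and \<open>X\<^sub>3\<close> is the maximum with probability one half, so the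
  regression function \<open>r\<close> of \<open>min X\<^sub>1 X\<^sub>2\<close> satisfies \<open>2 F r = m F + K\<close>. With \<open>dm = (1 - F) dy\<close> and
  \<open>dK = m dF\<close> this reads \<open>2 (m - r) d(ln F) + 2 d(m - r) = dm\<close>. Let \<open>G\<close>, \<open>n\<close> belong to a second
  distribution with the same \<open>r\<close>. Subtracting the two equations shows that, wherever \<open>F \<le> G\<close> and
  \<open>m > n\<close>, the ratio \<open>F / G\<close> and the difference \<open>n - m\<close> are decreasing; such a situation therefore
  persists up to the right end point, where \<open>F\<close> and \<open>G\<close> both tend to 1, and so it cannot occur with
  \<open>F < G\<close>. Hence \<open>(m - n) * (m - n)'\<close>, which is \<open>(m - n) * (G - F)\<close>, is never positive, and
  \<open>(m - n)\<^sup>2\<close> decreases from its limit 0 at \<open>-\<infinity>\<close>. So \<open>m = n\<close> and \<open>F = G\<close>, without any shift even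
  when \<open>(a, b)\<close> is the whole line. The other regression is reduced to this one by \<open>X \<mapsto> - X\<close>.
\<close>

section \<open>Uniqueness for the regression equation\<close>

lemma einterval_intermediate:
  "a < ereal u \<Longrightarrow> u \<le> v \<Longrightarrow> v \<le> w \<Longrightarrow> w \<in> einterval a b \<Longrightarrow> v \<in> einterval a b"
  using less_le_trans[of a "ereal u" "ereal v"] le_less_trans[of "ereal v" "ereal w" b]
  by (auto simp: einterval_def)

text \<open>
  For a random variable \<open>X\<close> with distribution function \<open>F\<close>, the intended instance is
  \<open>m y = E (min X y)\<close> and \<open>K y = E (m X; X \<le> y)\<close>; the bounds on the increments of \<open>K\<close> stand
  for \<open>dK = m * dF\<close>.
\<close>
locale overlap_regression =
  fixes a b :: ereal and r F m K :: "real \<Rightarrow> real"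
  assumes F_mono: "x \<le> y \<Longrightarrow> F x \<le> F y"
    and F_le_1: "F x \<le> 1"
    and F_nonneg: "0 \<le> F x"
    and F_cont: "isCont F x"
    and F_eq_0: "ereal x \<le> a \<Longrightarrow> F x = 0"
    and F_pos: "x \<in> einterval a b \<Longrightarrow> 0 < F x"
    and F_top: "c < 1 \<Longrightarrow> \<exists>t\<in>einterval a b. c < F t"
    and m_deriv: "(m has_real_derivative 1 - F x) (at x)"
    and m_lim: "((\<lambda>y. m y - y) \<longlongrightarrow> 0) at_bot"
    and K_lower: "y \<le> z \<Longrightarrow> m y * (F z - F y) \<le> K z - K y"
    and K_upper: "y \<le> z \<Longrightarrow> K z - K y \<le> m z * (F z - F y)"
    and K_le: "K y \<le> m y * F y"
    and regression: "y \<in> einterval a b \<Longrightarrow> 2 * F y * r y = m y * F y + K y"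
begin

lemma m_lipschitz:
  assumes "y \<le> z" shows "m z - m y \<le> z - y"
proof -
  have "(\<lambda>t. m t - t) z \<le> (\<lambda>t. m t - t) y"
  proof (rule DERIV_nonpos_imp_nonincreasing[OF assms])
    fix x
    have "((\<lambda>t. m t - t) has_real_derivative (1 - F x) - 1) (at x)"
      by (intro derivative_intros m_deriv)
    then show "\<exists>D. ((\<lambda>t. m t - t) has_real_derivative D) (at x) \<and> D \<le> 0"
      using F_nonneg by (intro exI[of _ "- F x"]) simp
  qed
  then show ?thesis by simp
qed

text \<open>By \<open>K_le\<close>, the right-hand side of the regression equation is at most
  \<open>2 * m y * F y\<close>.\<close>

lemma r_le_m: "y \<in> einterval a b \<Longrightarrow> r y \<le> m y"
proof -
  assume y: "y \<in> einterval a b"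
  then have "F y * r y \<le> F y * m y"
    using regression[OF y] K_le[of y] by (simp add: algebra_simps)
  then show ?thesis using F_pos[OF y] by simp
qed

text \<open>In differential form: \<open>d (2 * (m - r) * F) = F * dm\<close>.\<close>
lemma increment_bounds:
  assumes "y \<in> einterval a b" "z \<in> einterval a b" "y \<le> z"
  shows "F y * (m z - m y) \<le> 2 * (m z - r z) * F z - 2 * (m y - r y) * F y"
    and "2 * (m z - r z) * F z - 2 * (m y - r y) * F y \<le> F z * (m z - m y)"
proof -
  \<comment> \<open>The regression equation turns \<open>2 * (m - r) * F\<close> into
    \<open>m * F - K\<close>. In its differential the two terms \<open>m * dF\<close> cancel, which
    is where the bounds on the increments of \<open>K\<close> enter.\<close>
  have U: "2 * (m t - r t) * F t = m t * F t - K t" if "t \<in> einterval a b" for t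
    using regression[OF that] by (simp add: algebra_simps)
  show "F y * (m z - m y) \<le> 2 * (m z - r z) * F z - 2 * (m y - r y) * F y"
    unfolding U[OF assms(1)] U[OF assms(2)] using K_upper[OF assms(3)] by (simp add: algebra_simps)
  show "2 * (m z - r z) * F z - 2 * (m y - r y) * F y \<le> F z * (m z - m y)"
    unfolding U[OF assms(1)] U[OF assms(2)] using K_lower[OF assms(3)] by (simp add: algebra_simps)
qed

end

text \<open>One step of a discretised comparison. Dividing the increment bounds by
  \<open>F z\<close> and \<open>G z\<close> isolates the increment of \<open>r\<close>, which is
  common to both distributions and cancels. The bound on \<open>z - y\<close> lets the gap
  \<open>m y - n y\<close> absorb the second-order term, the increment of \<open>n\<close> times
  that of \<open>ln G\<close>.\<close>

lemma cdf_ratio_step: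
  assumes "overlap_regression a b r F m K" and "overlap_regression a b r G n L"
    and I: "y \<in> einterval a b" "z \<in> einterval a b" and "y \<le> z"
    and gap: "n y < m y" "z - y \<le> 2 * (m y - n y)" "m y - n y \<le> m z - n z"
  shows "F z * G y \<le> F y * G z"
proof -
  interpret f: overlap_regression a b r F m K by fact
  interpret g: overlap_regression a b r G n L by fact
  have pos: "0 < F z" "0 < G z" using I f.F_pos g.F_pos by auto
  \<comment> \<open>Relative increments, the discrete forms of \<open>d (ln F)\<close> and
    \<open>d (ln G)\<close>; the claim amounts to \<open>p\<close> being at most
    \<open>q\<close>.\<close>
  define p q where "p = 1 - F y / F z" and "q = 1 - G y / G z"
  have q: "0 \<le> q" using g.F_mono[OF \<open>y \<le> z\<close>] pos by (simp add: q_def)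
  have "2 * (m z - r z) - 2 * (m y - r y) * (F y / F z) \<le> m z - m y"
    using f.increment_bounds(2)[OF I \<open>y \<le> z\<close>] pos by (simp add: field_simps)
  then have 1: "2 * (m y - r y) * p + 2 * ((m z - m y) - (r z - r y)) \<le> m z - m y"
    by (simp add: p_def algebra_simps)
  have "(G y / G z) * (n z - n y) \<le> 2 * (n z - r z) - 2 * (n y - r y) * (G y / G z)"
    using divide_right_mono[OF g.increment_bounds(1)[OF I \<open>y \<le> z\<close>], of "G z"] pos
    by (simp add: diff_divide_distrib)
  then have 2: "(1 - q) * (n z - n y) \<le> 2 * (n y - r y) * q + 2 * ((n z - n y) - (r z - r y))"
    by (simp add: q_def algebra_simps)
  \<comment> \<open>Eliminating \<open>r z - r y\<close> leaves the extra summand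
    \<open>(n z - n y) - (m z - m y)\<close>, which is at most 0 because the gap has not
    shrunk.\<close>
  have "2 * (m y - r y) * p \<le> (2 * (n y - r y) + (n z - n y)) * q"
    using 1 2 gap(3) by (simp add: algebra_simps)
  also have "\<dots> \<le> 2 * (m y - r y) * q"
    using g.m_lipschitz[OF \<open>y \<le> z\<close>] gap(2) q by (intro mult_right_mono) auto
  \<comment> \<open>The common factor is positive, since \<open>r y\<close> is at most
    \<open>n y\<close> and \<open>n y < m y\<close>.\<close>
  finally have "p \<le> q"
    using g.r_le_m[OF I(1)] gap(1) by simp
  then show ?thesis
    using pos by (simp add: p_def q_def field_simps)
qed

text \<open>
  At the first point \<open>T\<close> where \<open>F / G\<close> reaches a value strictly between its value at \<open>y\<close> and 1, the
  difference \<open>m - n\<close> has been increasing all the way, so \<open>F / G\<close> has been decreasing all the way.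
\<close>
lemma cdf_less_imp_mean_le:
  assumes "overlap_regression a b r F m K" and "overlap_regression a b r G n L"
    and y: "y \<in> einterval a b" and less: "F y < G y"
  shows "m y \<le> n y"
proof (rule ccontr)
  interpret f: overlap_regression a b r F m K by fact
  interpret g: overlap_regression a b r G n L by fact
  assume "\<not> m y \<le> n y"
  define d where "d = m y - n y"
  have d: "0 < d" using \<open>\<not> m y \<le> n y\<close> by (simp add: d_def)
  have Gy: "0 < G y" using y by (rule g.F_pos)
  \<comment> \<open>The midpoint of \<open>F y / G y\<close> and 1. The ratio starts below it, and
    has passed it once \<open>F\<close> exceeds \<open>c\<close>, because \<open>G\<close> is at
    most 1.\<close>
  define c where "c = (F y / G y + 1) / 2"
  have c: "F y < c * G y" "c < 1" "0 < c"
    using less Gy f.F_nonneg[of y] by (auto simp: c_def field_simps add_nonneg_pos)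
  obtain t where t: "t \<in> einterval a b" "c < F t" using f.F_top[OF c(2)] by blast
  have "y \<le> t"
  proof (rule ccontr)
    assume "\<not> y \<le> t"
    then have "c < F y" using f.F_mono[of t y] t by simp
    moreover have "c * G y \<le> c" using g.F_le_1[of y] c by (simp add: mult_left_le)
    ultimately show False using c by simp
  qed
  \<comment> \<open>The points up to \<open>t\<close> at which the ratio is at least
    \<open>c\<close>. By continuity this set is compact, so it has a least element
    \<open>T\<close>.\<close>
  define S where "S = {y..t} \<inter> {u. 0 \<le> F u - c * G u}"
  have "closed {u. 0 \<le> F u - c * G u}"
    by (intro closed_Collect_le continuous_intros continuous_at_imp_continuous_on ballI f.F_cont g.F_cont)
  then have "compact S" unfolding S_def by (intro compact_Int_closed) auto
  moreover have "c * G t \<le> c" using g.F_le_1[of t] c by (simp add: mult_left_le)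
  then have "t \<in> S"
    using \<open>y \<le> t\<close> t(2) by (simp add: S_def)
  ultimately obtain T where T: "T \<in> S" "\<And>u. u \<in> S \<Longrightarrow> T \<le> u"
    using compact_attains_inf[of S] by blast
  have yT: "y \<le> T" "T \<le> t" "c * G T \<le> F T" using T(1) by (auto simp: S_def)
  have before: "F u \<le> G u" if "y \<le> u" "u < T" for u
  proof -
    have "u \<notin> S" using T(2)[of u] that by auto
    then have "F u \<le> c * G u" using that yT by (auto simp: S_def)
    also have "\<dots> \<le> G u" using c g.F_nonneg[of u] by (simp add: mult_left_le_one_le)
    finally show ?thesis .
  qed
  \<comment> \<open>The derivative of \<open>m - n\<close> is \<open>G - F\<close>, and before
    \<open>T\<close> the ratio \<open>F / G\<close> is below \<open>c < 1\<close>.\<close>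
  have gap_mono: "m u - n u \<le> m v - n v" if "y \<le> u" "u \<le> v" "v \<le> T" for u v
  proof (rule DERIV_nonneg_imp_increasing_open[OF \<open>u \<le> v\<close>])
    fix x assume "u < x" "x < v"
    then have "F x \<le> G x" using that by (intro before) auto
    moreover have "((\<lambda>x. m x - n x) has_real_derivative (1 - F x) - (1 - G x)) (at x)"
      by (intro derivative_intros f.m_deriv g.m_deriv)
    ultimately show "\<exists>D. ((\<lambda>x. m x - n x) has_real_derivative D) (at x) \<and> 0 \<le> D"
      by (intro exI[of _ "(1 - F x) - (1 - G x)"]) simp
  next
    show "continuous_on {u..v} (\<lambda>x. m x - n x)"
      by (intro continuous_intros DERIV_continuous_on[of _ _ "\<lambda>x. 1 - F x"]
            DERIV_continuous_on[of _ _ "\<lambda>x. 1 - G x"] DERIV_subset[OF f.m_deriv] DERIV_subset[OF g.m_deriv]) auto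
  qed
  have inI: "u \<in> einterval a b" if "y \<le> u" "u \<le> T" for u
    using that y t yT(2) by (intro einterval_intermediate[of a y u t b]) (auto simp: einterval_def)
  \<comment> \<open>The gap stays at least \<open>d\<close> up to \<open>T\<close>, so every step of
    length at most \<open>2 * d\<close> is admissible for \<open>cdf_ratio_step\<close>;
    \<open>k\<close> bounds the number of steps from \<open>y\<close> to \<open>z\<close>.\<close>
  have chain: "F z / G z \<le> F y / G y" if "y \<le> z" "z \<le> T" "z - y \<le> real k * (2 * d)" for k z
    using that
  proof (induction k arbitrary: z)
    case 0
    then have "z = y" by simp
    then show ?case by simp
  next
    case (Suc k)
    \<comment> \<open>Start of the last step; the maximum shortens a step that would reach back
      beyond \<open>y\<close>.\<close>
    define u where "u = max y (z - 2 * d)"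
    have u: "y \<le> u" "u \<le> z" "z - u \<le> 2 * d" "u - y \<le> real k * (2 * d)"
      using Suc.prems d by (auto simp: u_def algebra_simps)
    have "d \<le> m u - n u" using gap_mono[of y u] u Suc.prems by (simp add: d_def)
    then have "F z * G u \<le> F u * G z"
      using u Suc.prems d gap_mono[of u z]
      by (intro cdf_ratio_step[OF assms(1,2) inI inI]) auto
    then have "F z / G z \<le> F u / G u"
      using g.F_pos[OF inI, of u] g.F_pos[OF inI, of z] u Suc.prems by (simp add: field_simps)
    also have "\<dots> \<le> F y / G y" using u Suc.prems by (intro Suc.IH) auto
    finally show ?case .
  qed
  obtain k :: nat where "(T - y) / (2 * d) \<le> real k" using real_arch_simple by blast
  then have "F T / G T \<le> F y / G y" using d yT by (intro chain[of T k]) (auto simp: field_simps)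
  moreover have "c \<le> F T / G T" using yT g.F_pos[OF inI, of T] by (simp add: field_simps)
  moreover have "F y / G y < c" using c Gy by (simp add: field_simps)
  ultimately show False by simp
qed

text \<open>If \<open>m y\<close> were at least \<open>n y\<close>, the positive derivative
  \<open>G y - F y\<close> would make \<open>m - n\<close> positive just to the right of
  \<open>y\<close>, while \<open>F < G\<close> persists there by continuity. This contradicts
  \<open>cdf_less_imp_mean_le\<close>.\<close>

lemma cdf_less_imp_mean_less:
  assumes "overlap_regression a b r F m K" and "overlap_regression a b r G n L"
    and y: "y \<in> einterval a b" and less: "F y < G y"
  shows "m y < n y"
proof (rule ccontr)
  interpret f: overlap_regression a b r F m K by fact
  interpret g: overlap_regression a b r G n L by fact
  assume "\<not> m y < n y"
  have "((\<lambda>x. m x - n x) has_real_derivative (1 - F y) - (1 - G y)) (at y)"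
    by (intro derivative_intros f.m_deriv g.m_deriv)
  from DERIV_pos_inc_right[OF this] less
  obtain e where e: "0 < e" "\<And>h. 0 < h \<Longrightarrow> h < e \<Longrightarrow> m y - n y < m (y + h) - n (y + h)" by auto
  have "\<forall>\<^sub>F x in at_right y. m y - n y < m x - n x"
    unfolding eventually_at_right_field
  proof (intro exI[of _ "y + e"] conjI allI impI)
    show "y < y + e" using e by simp
    show "m y - n y < m x - n x" if "y < x" "x < y + e" for x using e(2)[of "x - y"] that by simp
  qed
  moreover have "\<forall>\<^sub>F x in at_right y. 0 < G x - F x"
    using less by (intro order_tendstoD(1)[of _ "G y - F y"] tendsto_diff
      tendsto_within_subset[OF isContD[OF f.F_cont]] tendsto_within_subset[OF isContD[OF g.F_cont]]) auto
  moreover have "\<forall>\<^sub>F x in at_right y. x \<in> einterval a b"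
    using eventually_at_topological open_einterval y by blast
  ultimately have "\<forall>\<^sub>F x in at_right y. False"
    by eventually_elim
      (use cdf_less_imp_mean_le[OF assms(1,2)] \<open>\<not> m y < n y\<close> in force)
  then show False by simp
qed

theorem overlap_regression_unique:
  assumes F: "overlap_regression a b r F m K" and G: "overlap_regression a b r G n L"
    and x: "x \<in> einterval a b"
  shows "F x = G x"
proof -
  interpret f: overlap_regression a b r F m K by fact
  interpret g: overlap_regression a b r G n L by fact
  \<comment> \<open>Half the derivative of the square is \<open>(m - n) * (G - F)\<close>. Inside
    the interval its sign follows from the strict comparison applied in both orders; at or below
    \<open>a\<close> both distribution functions vanish.\<close>
  have sq: "(m v - n v)\<^sup>2 \<le> (m u - n u)\<^sup>2" if "u \<le> v" "v \<le> x" for u v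
  proof (rule DERIV_nonpos_imp_nonincreasing[OF \<open>u \<le> v\<close>])
    fix t assume "u \<le> t" "t \<le> v"
    have "(m t - n t) * (G t - F t) \<le> 0"
    proof (cases "ereal t \<le> a")
      case True
      then show ?thesis by (simp add: f.F_eq_0 g.F_eq_0)
    next
      case False
      then have t: "t \<in> einterval a b"
        using x \<open>t \<le> v\<close> \<open>v \<le> x\<close> by (intro einterval_intermediate[of a t t x b]) auto
      show ?thesis
        using cdf_less_imp_mean_less[OF F G t] cdf_less_imp_mean_less[OF G F t]
        by (cases "F t" "G t" rule: linorder_cases) (auto simp: mult_le_0_iff)
    qed
    moreover have "((\<lambda>t. (m t - n t)\<^sup>2) has_real_derivative
        2 * ((m t - n t) * (G t - F t))) (at t)"
      by (rule derivative_eq_intros f.m_deriv g.m_deriv refl | simp add: algebra_simps)+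
    ultimately show "\<exists>D. ((\<lambda>t. (m t - n t)\<^sup>2) has_real_derivative D) (at t) \<and> D \<le> 0"
      by (intro exI[of _ "2 * ((m t - n t) * (G t - F t))"] conjI) linarith+
  qed
  \<comment> \<open>Subtracting \<open>u\<close> from both means shows that \<open>m - n\<close>
    vanishes at minus infinity, so its decreasing square is 0 at \<open>x\<close>.\<close>
  have "((\<lambda>u. ((m u - u) - (n u - u))\<^sup>2) \<longlongrightarrow> (0 - 0)\<^sup>2) at_bot"
    by (intro tendsto_intros f.m_lim g.m_lim)
  moreover have "\<forall>\<^sub>F u in at_bot. (m x - n x)\<^sup>2 \<le> ((m u - u) - (n u - u))\<^sup>2"
    using eventually_le_at_bot[of x] by eventually_elim (use sq in auto)
  ultimately have "(m x - n x)\<^sup>2 \<le> (0 - 0)\<^sup>2"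
    by (rule tendsto_lowerbound) simp
  then have "m x = n x" by simp
  then show ?thesis
    using cdf_less_imp_mean_less[OF F G x] cdf_less_imp_mean_less[OF G F x]
    by (cases "F x" "G x" rule: linorder_cases) auto
qed

section \<open>Truncated means\<close>

text \<open>Serves as \<open>m\<close>: for independent variables with law \<mu>, the mean of
  \<open>min X1 X2\<close> given that \<open>X2\<close> equals \<open>y\<close>.\<close>

definition trunc_mean :: "real measure \<Rightarrow> real \<Rightarrow> real" where
  "trunc_mean \<mu> y = (\<integral>x. min x y \<partial>\<mu>)"

text \<open>Serves as \<open>K\<close>: by Fubini, the mean of \<open>min X1 X2\<close> over the
  event that \<open>X2\<close> is at most \<open>y\<close>.\<close>

definition trunc_mean_below :: "real measure \<Rightarrow> real \<Rightarrow> real" where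
  "trunc_mean_below \<mu> y = (\<integral>x. indicator {..y} x * trunc_mean \<mu> x \<partial>\<mu>)"

text \<open>Integrability is imposed on the minimum of two independent copies, which still allows a
  single copy to have an infinite mean in the upper tail.\<close>

locale min_integrable_distribution = real_distribution \<mu> for \<mu> :: "real measure" +
  assumes atomless: "measure \<mu> {x} = 0"
    and integrable_min_pair: "integrable (\<mu> \<Otimes>\<^sub>M \<mu>) (\<lambda>(x, y). min x y)"
begin

sublocale pair: pair_sigma_finite \<mu> \<mu> ..

text \<open>Fubini gives integrability for almost every truncation level, hence for some level
  \<open>z\<close>. Moving the level to \<open>y\<close> changes the minimum by at most
  \<open>\<bar>y - z\<bar>\<close>.\<close>

lemma integrable_min: "integrable \<mu> (\<lambda>x. min x y)"
proof -
  have "AE z in \<mu>. integrable \<mu> (\<lambda>x. min x z)"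
    using pair.AE_integrable_snd[OF integrable_min_pair] .
  then obtain z where z: "integrable \<mu> (\<lambda>x. min x z)"
    using AE_False by (metis (mono_tags, lifting) eventually_mono)
  show ?thesis
  proof (rule Bochner_Integration.integrable_bound)
    show "integrable \<mu> (\<lambda>x. \<bar>min x z\<bar> + \<bar>y - z\<bar>)" using z by auto
  qed auto
qed

lemma integrable_trunc_mean: "integrable \<mu> (trunc_mean \<mu>)"
  unfolding trunc_mean_def [abs_def] using pair.integrable_snd[OF integrable_min_pair] .

lemma integrable_indicator_trunc_mean [intro, simp]:
  assumes "A \<in> sets borel" shows "integrable \<mu> (\<lambda>x. indicator A x * trunc_mean \<mu> x)"
  using integrable_mult_indicator[OF _ integrable_trunc_mean, of A] assms by simp

lemma integrable_indicator_mult: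
  fixes c :: real
  assumes "A \<in> sets borel" shows "integrable \<mu> (\<lambda>x. indicator A x * c)"
  using assms by (intro integrable_mult_left) (simp add: emeasure_eq_measure)

lemma measure_greaterThan: "measure \<mu> {y<..} = 1 - cdf \<mu> y"
proof -
  have "UNIV - {..y} = {y<..}" by auto
  then show ?thesis using prob_compl[of "{..y}"] by (simp add: cdf_def2)
qed

text \<open>The integrand \<open>min x z - min x y\<close> equals \<open>z - y\<close> above
  \<open>z\<close>, is 0 below \<open>y\<close>, and lies between these values elsewhere.\<close>

lemma trunc_mean_increment:
  assumes "y \<le> z"
  shows "(1 - cdf \<mu> z) * (z - y) \<le> trunc_mean \<mu> z - trunc_mean \<mu> y"
    and "trunc_mean \<mu> z - trunc_mean \<mu> y \<le> (1 - cdf \<mu> y) * (z - y)"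
proof -
  have diff: "trunc_mean \<mu> z - trunc_mean \<mu> y = (\<integral>x. min x z - min x y \<partial>\<mu>)"
    unfolding trunc_mean_def by (simp add: integrable_min)
  have ind: "(\<integral>x. indicator {t<..} x * (z - y) \<partial>\<mu>) = (1 - cdf \<mu> t) * (z - y)" for t
    by (simp add: measure_greaterThan)
  show "(1 - cdf \<mu> z) * (z - y) \<le> trunc_mean \<mu> z - trunc_mean \<mu> y"
    unfolding diff ind[symmetric] using assms
    by (intro integral_mono integrable_indicator_mult Bochner_Integration.integrable_diff integrable_min)
      (auto simp: indicator_def)
  show "trunc_mean \<mu> z - trunc_mean \<mu> y \<le> (1 - cdf \<mu> y) * (z - y)"
    unfolding diff ind[symmetric] using assms
    by (intro integral_mono integrable_indicator_mult Bochner_Integration.integrable_diff integrable_min)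
      (auto simp: indicator_def)
qed

lemma trunc_mean_mono: "y \<le> z \<Longrightarrow> trunc_mean \<mu> y \<le> trunc_mean \<mu> z"
  unfolding trunc_mean_def by (intro integral_mono integrable_indicator_mult integrable_min) auto

lemma isCont_cdf_atomless: "isCont (cdf \<mu>) x"
  by (simp add: isCont_cdf atomless)

lemma trunc_mean_deriv: "(trunc_mean \<mu> has_real_derivative 1 - cdf \<mu> x) (at x)"
  unfolding has_field_derivative_iff
proof (rule Lim_transform)
  \<comment> \<open>The quotient is compared with \<open>1 - cdf \<mu> y\<close> at the moving
    point: both lie between the values of \<open>1 - cdf \<mu>\<close> at \<open>x\<close> and
    \<open>y\<close>, so continuity closes the squeeze.\<close>
  show "((\<lambda>y. 1 - cdf \<mu> y) \<longlongrightarrow> 1 - cdf \<mu> x) (at x)"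
    by (intro tendsto_intros isContD isCont_cdf_atomless)
  show "((\<lambda>y. (trunc_mean \<mu> y - trunc_mean \<mu> x) / (y - x) - (1 - cdf \<mu> y)) \<longlongrightarrow> 0) (at x)"
  proof (rule Lim_null_comparison)
    show "((\<lambda>y. \<bar>cdf \<mu> y - cdf \<mu> x\<bar>) \<longlongrightarrow> 0) (at x)"
      using isContD[OF isCont_cdf_atomless[of x]] by (simp add: LIM_zero tendsto_rabs_zero)
    have "\<bar>(trunc_mean \<mu> y - trunc_mean \<mu> x) / (y - x) - (1 - cdf \<mu> y)\<bar> \<le> \<bar>cdf \<mu> y - cdf \<mu> x\<bar>"
      if "y \<noteq> x" for y
    proof (cases "x < y")
      case True
      then have "1 - cdf \<mu> y \<le> (trunc_mean \<mu> y - trunc_mean \<mu> x) / (y - x)"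
        "(trunc_mean \<mu> y - trunc_mean \<mu> x) / (y - x) \<le> 1 - cdf \<mu> x"
        using trunc_mean_increment[of x y] by (auto simp: pos_le_divide_eq pos_divide_le_eq)
      then show ?thesis by linarith
    next
      case False
      with that have "y < x" by simp
      have "(trunc_mean \<mu> y - trunc_mean \<mu> x) / (y - x) = (trunc_mean \<mu> x - trunc_mean \<mu> y) / (x - y)"
        by (metis minus_diff_eq minus_divide_divide)
      moreover have "1 - cdf \<mu> x \<le> (trunc_mean \<mu> x - trunc_mean \<mu> y) / (x - y)"
        "(trunc_mean \<mu> x - trunc_mean \<mu> y) / (x - y) \<le> 1 - cdf \<mu> y"
        using trunc_mean_increment[of y x] \<open>y < x\<close> by (auto simp: pos_le_divide_eq pos_divide_le_eq)
      ultimately show ?thesis by linarith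
    qed
    then show "\<forall>\<^sub>F y in at x. norm ((trunc_mean \<mu> y - trunc_mean \<mu> x) / (y - x) - (1 - cdf \<mu> y))
        \<le> \<bar>cdf \<mu> y - cdf \<mu> x\<bar>"
      by (auto simp: eventually_at_filter)
  qed
qed

text \<open>Dominated convergence after the reflection of \<open>y\<close>: for each
  \<open>x\<close> the integrand \<open>min x (- y) + y\<close> is eventually 0, and for nonnegative
  \<open>y\<close> it is bounded by \<open>\<bar>min x 0\<bar>\<close>.\<close>

lemma trunc_mean_at_bot: "((\<lambda>y. trunc_mean \<mu> y - y) \<longlongrightarrow> 0) at_bot"
  unfolding filterlim_at_bot_mirror
proof -
  have "((\<lambda>y. \<integral>x. min x (- y) + y \<partial>\<mu>) \<longlongrightarrow> (\<integral>x. 0 \<partial>\<mu>)) at_top"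
  proof (rule integral_dominated_convergence_at_top)
    show "integrable \<mu> (\<lambda>x. \<bar>min x 0\<bar>)" using integrable_min[of 0] by auto
    have "((\<lambda>y. min x (- y) + y) \<longlongrightarrow> 0) at_top" for x :: real
    proof (rule tendsto_eventually)
      show "\<forall>\<^sub>F y in at_top. min x (- y) + y = 0"
        using eventually_ge_at_top[of "- x"] by eventually_elim auto
    qed
    then show "AE x in \<mu>. ((\<lambda>y. min x (- y) + y) \<longlongrightarrow> 0) at_top" by simp
    show "\<forall>\<^sub>F y in at_top. AE x in \<mu>. norm (min x (- y) + y) \<le> \<bar>min x 0\<bar>"
      using eventually_ge_at_top[of 0] by eventually_elim (intro AE_I2, auto)
  qed auto
  moreover have "(\<integral>x. min x (- y) + y \<partial>\<mu>) = trunc_mean \<mu> (- y) - (- y)" for y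
    using prob_space by (simp add: trunc_mean_def integrable_min)
  ultimately show "((\<lambda>y. trunc_mean \<mu> (- y) - (- y)) \<longlongrightarrow> 0) at_top" by simp
qed

text \<open>The increment is the integral of the monotone function \<open>trunc_mean \<mu>\<close>
  over \<open>{y<..z}\<close>.\<close>

lemma trunc_mean_below_increment:
  assumes "y \<le> z"
  shows "trunc_mean \<mu> y * (cdf \<mu> z - cdf \<mu> y) \<le> trunc_mean_below \<mu> z - trunc_mean_below \<mu> y"
    and "trunc_mean_below \<mu> z - trunc_mean_below \<mu> y \<le> trunc_mean \<mu> z * (cdf \<mu> z - cdf \<mu> y)"
proof -
  have "{..z} - {..y} = {y<..z}" by auto
  then have cdf: "cdf \<mu> z - cdf \<mu> y = measure \<mu> {y<..z}"
    using finite_measure_Diff[of "{..z}" "{..y}"] assms by (simp add: cdf_def2)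
  have "trunc_mean_below \<mu> z - trunc_mean_below \<mu> y
      = (\<integral>x. indicator {..z} x * trunc_mean \<mu> x - indicator {..y} x * trunc_mean \<mu> x \<partial>\<mu>)"
    unfolding trunc_mean_below_def by simp
  also have "\<dots> = (\<integral>x. indicator {y<..z} x * trunc_mean \<mu> x \<partial>\<mu>)"
    using assms by (intro Bochner_Integration.integral_cong) (auto simp: indicator_def)
  finally have diff: "trunc_mean_below \<mu> z - trunc_mean_below \<mu> y
    = (\<integral>x. indicator {y<..z} x * trunc_mean \<mu> x \<partial>\<mu>)" .
  have ind: "(\<integral>x. indicator {y<..z} x * c \<partial>\<mu>) = c * (cdf \<mu> z - cdf \<mu> y)" for c
    by (simp add: cdf)
  show "trunc_mean \<mu> y * (cdf \<mu> z - cdf \<mu> y) \<le> trunc_mean_below \<mu> z - trunc_mean_below \<mu> y"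
    unfolding diff ind[symmetric]
    by (intro integral_mono integrable_indicator_mult integrable_indicator_trunc_mean)
      (auto simp: indicator_def trunc_mean_mono)
  show "trunc_mean_below \<mu> z - trunc_mean_below \<mu> y \<le> trunc_mean \<mu> z * (cdf \<mu> z - cdf \<mu> y)"
    unfolding diff ind[symmetric]
    by (intro integral_mono integrable_indicator_mult integrable_indicator_trunc_mean)
      (auto simp: indicator_def trunc_mean_mono)
qed

lemma trunc_mean_below_le: "trunc_mean_below \<mu> y \<le> trunc_mean \<mu> y * cdf \<mu> y"
proof -
  have "trunc_mean_below \<mu> y \<le> (\<integral>x. indicator {..y} x * trunc_mean \<mu> y \<partial>\<mu>)"
    unfolding trunc_mean_below_def
    by (intro integral_mono integrable_indicator_mult integrable_mult_left integrable_indicator_trunc_mean)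
      (auto simp: indicator_def trunc_mean_mono emeasure_eq_measure)
  also have "\<dots> = trunc_mean \<mu> y * cdf \<mu> y" by (simp add: cdf_def2)
  finally show ?thesis .
qed

text \<open>At a finite \<open>b\<close> the value is 1 and continuity from the left applies; at
  infinity the limit of the distribution function does.\<close>

lemma cdf_exceeds:
  assumes "interval_support \<mu> a b" "a < b" "c < 1"
  shows "\<exists>t\<in>einterval a b. c < cdf \<mu> t"
proof -
  obtain s where s: "\<And>t. s < t \<Longrightarrow> ereal t < b \<Longrightarrow> c < cdf \<mu> t" "ereal s < b"
  proof (cases b)
    case (real \<beta>)
    then have "cdf \<mu> \<beta> = 1" using assms(1) by (simp add: interval_support_def)
    then have "(cdf \<mu> \<longlongrightarrow> 1) (at_left \<beta>)"
      using tendsto_within_subset[OF isContD[OF isCont_cdf_atomless[of \<beta>]]] by simp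
    then have "\<forall>\<^sub>F t in at_left \<beta>. c < cdf \<mu> t" using assms(3) by (rule order_tendstoD)
    then show ?thesis using that real by (auto simp: eventually_at_left_field)
  next
    case PInf
    have "\<forall>\<^sub>F t in at_top. c < cdf \<mu> t" using cdf_lim_at_top_prob assms(3) by (rule order_tendstoD)
    then show ?thesis using that PInf by (auto simp: eventually_at_top_dense)
  qed (use \<open>a < b\<close> in simp)
  have "max a (ereal s) < b" using s assms(2) by simp
  then obtain t where "max a (ereal s) < ereal t" "ereal t < b" using ereal_dense2 by blast
  then show ?thesis using s(1)[of t] by (auto simp: einterval_def)
qed

lemma cdf_pos:
  assumes "interval_support \<mu> a b" "y \<in> einterval a b"
  shows "0 < cdf \<mu> y"
proof -
  obtain x where x: "a < ereal x" "ereal x < ereal y"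
    using assms(2) ereal_dense2[of a "ereal y"] by (auto simp: einterval_def)
  then have "x \<in> einterval a b" using assms(2) by (auto simp: einterval_def intro: less_trans[of "ereal x" "ereal y" b])
  then have "cdf \<mu> x < cdf \<mu> y"
    using assms x by (auto simp: interval_support_def strict_mono_on_def)
  then show ?thesis using cdf_nonneg[of x] by simp
qed

text \<open>
  The hypothesis is the defining property of the conditional expectation on the events
  \<open>y < max X\<^sub>2 X\<^sub>3 \<le> z\<close>; letting \<open>z\<close> decrease to \<open>y\<close> turns it into a pointwise equation.
\<close>
lemma overlap_regressionI:
  assumes supp: "interval_support \<mu> a b" and "a < b"
    and cont: "continuous_on (einterval a b) r"
    and slab: "\<And>y z l u. y < z \<Longrightarrow> (\<And>t. y < t \<Longrightarrow> t \<le> z \<Longrightarrow> l \<le> r t \<and> r t \<le> u) \<Longrightarrow>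
      l * ((cdf \<mu> z)\<^sup>2 - (cdf \<mu> y)\<^sup>2) \<le> cdf \<mu> z * trunc_mean_below \<mu> z - cdf \<mu> y * trunc_mean_below \<mu> y \<and>
      cdf \<mu> z * trunc_mean_below \<mu> z - cdf \<mu> y * trunc_mean_below \<mu> y \<le> u * ((cdf \<mu> z)\<^sup>2 - (cdf \<mu> y)\<^sup>2)"
  shows "overlap_regression a b r (cdf \<mu>) (trunc_mean \<mu>) (trunc_mean_below \<mu>)"
proof
  show "2 * cdf \<mu> y * r y = trunc_mean \<mu> y * cdf \<mu> y + trunc_mean_below \<mu> y"
    if y: "y \<in> einterval a b" for y
  proof -
    let ?F = "cdf \<mu>" and ?m = "trunc_mean \<mu>" and ?K = "trunc_mean_below \<mu>"
    have F: "(?F \<longlongrightarrow> ?F y) (at_right y)"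
      using tendsto_within_subset[OF isContD[OF isCont_cdf_atomless]] by auto
    have m: "(?m \<longlongrightarrow> ?m y) (at_right y)"
      using tendsto_within_subset[OF isContD[OF DERIV_isCont[OF trunc_mean_deriv]]] by auto
    have near: "(r y - e) * (2 * ?F y) \<le> ?F y * ?m y + ?K y \<and>
        ?F y * ?m y + ?K y \<le> (r y + e) * (2 * ?F y)" if "0 < e" for e
    proof -
      have "isCont r y" using cont y open_einterval continuous_on_eq_continuous_at by blast
      then have "\<forall>\<^sub>F t in nhds y. dist (r t) (r y) < e"
        using \<open>0 < e\<close> by (simp add: continuous_at_eps_delta eventually_nhds_metric)
      then have "\<forall>\<^sub>F t in nhds y. dist (r t) (r y) < e \<and> t \<in> einterval a b"
        using eventually_nhds_in_open[OF open_einterval y] by (rule eventually_conj)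
      then obtain d where d: "0 < d" "\<And>t. dist t y < d \<Longrightarrow> dist (r t) (r y) < e \<and> t \<in> einterval a b"
        by (auto simp: eventually_nhds_metric)
      have bounds: "(r y - e) * (?F z + ?F y) \<le> ?F z * ?m z + ?K y \<and>
          ?F z * ?m y + ?K y \<le> (r y + e) * (?F z + ?F y)" if z: "y < z" "z < y + d" for z
      proof -
        have D: "0 < ?F z - ?F y"
          using supp y d(2)[of z] z by (auto simp: interval_support_def strict_mono_on_def dist_real_def)
        have "r y - e \<le> r t \<and> r t \<le> r y + e" if "y < t" "t \<le> z" for t
          using d(2)[of t] that z by (auto simp: dist_real_def abs_less_iff)
        from slab[OF z(1) this]
        have *: "((r y - e) * (?F z + ?F y)) * (?F z - ?F y) \<le> ?F z * ?K z - ?F y * ?K y"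
          "?F z * ?K z - ?F y * ?K y \<le> ((r y + e) * (?F z + ?F y)) * (?F z - ?F y)"
          by (simp_all add: power2_eq_square algebra_simps)
        \<comment> \<open>This product rule makes the factor \<open>?F z - ?F y\<close> appear on
          this side too; the difference of squares contains it as well, and it is positive by
          \<open>D\<close>, so it can be cancelled.\<close>
        have K: "?F z * ?K z - ?F y * ?K y = ?F z * (?K z - ?K y) + ?K y * (?F z - ?F y)"
          by (simp add: algebra_simps)
        have "?F z * (?K z - ?K y) \<le> ?F z * (?m z * (?F z - ?F y))"
          "?F z * (?m y * (?F z - ?F y)) \<le> ?F z * (?K z - ?K y)"
          using trunc_mean_below_increment[of y z] z by (auto intro!: mult_left_mono cdf_nonneg)
        then have "?F z * ?K z - ?F y * ?K y \<le> (?F z * ?m z + ?K y) * (?F z - ?F y)"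
          "(?F z * ?m y + ?K y) * (?F z - ?F y) \<le> ?F z * ?K z - ?F y * ?K y"
          unfolding K by (simp_all add: algebra_simps)
        with * have "((r y - e) * (?F z + ?F y)) * (?F z - ?F y) \<le> (?F z * ?m z + ?K y) * (?F z - ?F y)"
          "(?F z * ?m y + ?K y) * (?F z - ?F y) \<le> ((r y + e) * (?F z + ?F y)) * (?F z - ?F y)"
          by (blast intro: order_trans)+
        then show ?thesis using D by (simp only: mult_le_cancel_right_pos simp_thms)
      qed
      have ev: "\<forall>\<^sub>F z in at_right y. y < z \<and> z < y + d"
        using d(1) by (auto simp: eventually_at_right_field intro!: exI[of _ "y + d"])
      \<comment> \<open>Limit of \<open>bounds\<close> as \<open>z\<close> decreases to
        \<open>y\<close>, by continuity of \<open>?F\<close> and \<open>?m\<close>.\<close>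
      have "(r y - e) * (?F y + ?F y) \<le> ?F y * ?m y + ?K y"
        by (rule tendsto_le[OF _ tendsto_add[OF tendsto_mult[OF F m] tendsto_const]
              tendsto_mult[OF tendsto_const tendsto_add[OF F tendsto_const]]])
          (use ev bounds in \<open>auto elim: eventually_mono\<close>)
      moreover have "?F y * ?m y + ?K y \<le> (r y + e) * (?F y + ?F y)"
        by (rule tendsto_le[OF _ tendsto_mult[OF tendsto_const tendsto_add[OF F tendsto_const]]
              tendsto_add[OF tendsto_mult[OF F tendsto_const] tendsto_const]])
          (use ev bounds in \<open>auto elim: eventually_mono\<close>)
      ultimately show ?thesis by simp
    qed
    \<comment> \<open>Taking \<open>e / 2\<close> in \<open>near\<close> leaves the error
      \<open>e * ?F y\<close>, which is at most \<open>e\<close>.\<close>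
    have "\<bar>2 * ?F y * r y - (?m y * ?F y + ?K y)\<bar> \<le> e" if "0 < e" for e
    proof -
      have "0 \<le> ?F y" "?F y \<le> 1" by (auto simp: cdf_nonneg cdf_bounded_prob)
      then have "e * ?F y \<le> e" using that by (simp add: mult_left_le)
      moreover have "2 * ?F y * r y - e * ?F y \<le> ?m y * ?F y + ?K y"
        "?m y * ?F y + ?K y \<le> 2 * ?F y * r y + e * ?F y"
        using near[of "e / 2"] that by (simp_all add: algebra_simps)
      ultimately show ?thesis by linarith
    qed
    then show ?thesis using dense_eq0_I by (metis eq_iff_diff_eq_0)
  qed
qed (use assms in \<open>auto simp: cdf_nondecreasing cdf_bounded_prob cdf_nonneg isCont_cdf_atomless
  cdf_pos cdf_exceeds trunc_mean_deriv trunc_mean_at_bot trunc_mean_below_increment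
  trunc_mean_below_le interval_support_def\<close>)

end

section \<open>Regression of order statistics of overlapping samples\<close>

lemma iid_tripleD:
  assumes "iid_triple M X \<mu>"
  shows "prob_space M" and "i \<in> {1, 2, 3} \<Longrightarrow> X i \<in> borel_measurable M"
    and "i \<in> {1, 2, 3} \<Longrightarrow> distr M borel (X i) = \<mu>" and "real_distribution \<mu>"
proof -
  show M: "prob_space M" using assms by (simp add: iid_triple_def)
  show "distr M borel (X i) = \<mu>" if "i \<in> {1, 2, 3}" for i
    using assms that unfolding iid_triple_def by blast
  show meas: "X i \<in> borel_measurable M" if "i \<in> {1, 2, 3}" for i
    using assms that M unfolding iid_triple_def prob_space.indep_vars_def[OF M] by blast
  show "real_distribution \<mu>"
    using assms prob_space.real_distribution_distr[OF M meas[of 1]] by (simp add: iid_triple_def)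
qed

lemma iid_triple_distr_pair:
  assumes iid: "iid_triple M X \<mu>" and ij: "i \<in> {1, 2, 3}" "j \<in> {1, 2, 3}" "i \<noteq> j"
  shows "distr M (borel \<Otimes>\<^sub>M borel) (\<lambda>\<omega>. (X i \<omega>, X j \<omega>)) = \<mu> \<Otimes>\<^sub>M \<mu>"
proof -
  interpret prob_space M using iid by (rule iid_tripleD)
  have "indep_vars (\<lambda>_. borel) X {1, 2, 3}" using iid by (simp add: iid_triple_def)
  from indep_var_compose[OF indep_var_restrict[OF this, of "{i}" "{j}"], of "\<lambda>f. f i" borel "\<lambda>f. f j" borel]
  have "indep_var borel (X i) borel (X j)" using ij by (auto simp: comp_def)
  then show ?thesis
    using ij iid_tripleD(3)[OF iid] unfolding indep_var_distribution_eq by simp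
qed

lemma iid_triple_min_integrable_distribution:
  assumes iid: "iid_triple M X \<mu>" and atomless: "\<And>x. measure \<mu> {x} = 0"
    and int: "integrable M (\<lambda>\<omega>. min (X 1 \<omega>) (X 2 \<omega>))"
  shows "min_integrable_distribution \<mu>"
proof -
  interpret real_distribution \<mu> using iid by (rule iid_tripleD)
  note [measurable] = iid_tripleD(2)[OF iid, of 1, simplified] iid_tripleD(2)[OF iid, of 2, simplified]
  have "integrable (distr M (borel \<Otimes>\<^sub>M borel) (\<lambda>\<omega>. (X 1 \<omega>, X 2 \<omega>))) (\<lambda>(x, y). min x y)"
    using int by (subst integrable_distr_eq) auto
  then have "integrable (\<mu> \<Otimes>\<^sub>M \<mu>) (\<lambda>(x, y). min x y)"
    using iid_triple_distr_pair[OF iid, of 1 2] by simp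
  then show ?thesis by unfold_locales (rule atomless)
qed

lemma iid_triple_measure_max_le:
  assumes iid: "iid_triple M X \<mu>"
  shows "measure M {\<omega> \<in> space M. max (X 2 \<omega>) (X 3 \<omega>) \<le> y} = (cdf \<mu> y)\<^sup>2"
proof -
  interpret real_distribution \<mu> using iid by (rule iid_tripleD)
  interpret M: prob_space M using iid by (rule iid_tripleD)
  interpret pair: pair_prob_space \<mu> \<mu> ..
  note [measurable] = iid_tripleD(2)[OF iid, of 2, simplified] iid_tripleD(2)[OF iid, of 3, simplified]
  have "(cdf \<mu> y)\<^sup>2 = measure (\<mu> \<Otimes>\<^sub>M \<mu>) ({..y} \<times> {..y})"
    by (simp add: measure_def emeasure_pair_measure_Times enn2real_mult cdf_def2 power2_eq_square)
  also have "\<dots> = measure (distr M (borel \<Otimes>\<^sub>M borel) (\<lambda>\<omega>. (X 2 \<omega>, X 3 \<omega>))) ({..y} \<times> {..y})"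
    using iid_triple_distr_pair[OF iid, of 2 3] by simp
  also have "\<dots> = measure M {\<omega> \<in> space M. max (X 2 \<omega>) (X 3 \<omega>) \<le> y}"
    by (subst measure_distr) (auto intro!: arg_cong[where f = "measure M"])
  finally show ?thesis by simp
qed

text \<open>The event requires both \<open>X 2\<close> and \<open>X 3\<close> to be at most
  \<open>y\<close>. The condition on \<open>X 3\<close> is independent of \<open>X 1\<close> and
  \<open>X 2\<close> and contributes \<open>cdf \<mu> y\<close>; Fubini identifies the remaining
  factor.\<close>

lemma iid_triple_expectation_min:
  assumes iid: "iid_triple M X \<mu>" and \<mu>: "min_integrable_distribution \<mu>"
    and int: "integrable M (\<lambda>\<omega>. min (X 1 \<omega>) (X 2 \<omega>))"
  shows "(\<integral>\<omega>. indicator {\<omega> \<in> space M. max (X 2 \<omega>) (X 3 \<omega>) \<le> y} \<omega> * min (X 1 \<omega>) (X 2 \<omega>) \<partial>M)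
    = cdf \<mu> y * trunc_mean_below \<mu> y"
proof -
  interpret M: prob_space M using iid by (rule iid_tripleD)
  interpret min_integrable_distribution \<mu> by (rule \<mu>)
  note [measurable] = iid_tripleD(2)[OF iid, of 1, simplified] iid_tripleD(2)[OF iid, of 2, simplified]
    iid_tripleD(2)[OF iid, of 3, simplified]
  define V where "V = (\<lambda>\<omega>. indicator {..y} (X 2 \<omega>) * min (X 1 \<omega>) (X 2 \<omega>))"
  define W :: "'a \<Rightarrow> real" where "W = (\<lambda>\<omega>. indicator {..y} (X 3 \<omega>))"
  have "M.indep_vars (\<lambda>_. borel) X {1, 2, 3}" using iid by (simp add: iid_triple_def)
  from M.indep_var_compose[OF M.indep_var_restrict[OF this, of "{1, 2}" "{3}"],
      of "\<lambda>f. indicator {..y} (f 2) * min (f 1) (f 2)" borel "\<lambda>f. indicator {..y} (f 3)" borel]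
  have indep: "M.indep_var borel V borel W" by (auto simp: comp_def V_def W_def)
  have intV: "integrable M V"
    unfolding V_def using int by (rule Bochner_Integration.integrable_bound) (auto simp: indicator_def)
  have intW: "integrable M W"
    unfolding W_def by (rule M.integrable_const_bound[of _ 1]) auto
  have "(\<integral>\<omega>. indicator {\<omega> \<in> space M. max (X 2 \<omega>) (X 3 \<omega>) \<le> y} \<omega> * min (X 1 \<omega>) (X 2 \<omega>) \<partial>M)
      = (\<integral>\<omega>. V \<omega> * W \<omega> \<partial>M)"
    by (intro Bochner_Integration.integral_cong) (auto simp: V_def W_def indicator_def)
  also have "\<dots> = (\<integral>\<omega>. V \<omega> \<partial>M) * (\<integral>\<omega>. W \<omega> \<partial>M)"
    by (rule M.indep_var_lebesgue_integral[OF indep intV intW])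
  also have "(\<integral>\<omega>. W \<omega> \<partial>M) = (\<integral>x. indicator {..y} x \<partial>distr M borel (X 3))"
    unfolding W_def by (subst integral_distr) auto
  also have "\<dots> = cdf \<mu> y"
    using iid_tripleD(3)[OF iid, of 3] by (simp add: cdf_def2)
  also have "(\<integral>\<omega>. V \<omega> \<partial>M) = (\<integral>p. indicator {..y} (snd p) * min (fst p) (snd p)
      \<partial>distr M (borel \<Otimes>\<^sub>M borel) (\<lambda>\<omega>. (X 1 \<omega>, X 2 \<omega>)))"
    unfolding V_def by (subst integral_distr) auto
  also have "\<dots> = (\<integral>(x, z). indicator {..y} z * min x z \<partial>(\<mu> \<Otimes>\<^sub>M \<mu>))"
    using iid_triple_distr_pair[OF iid, of 1 2] by (simp add: case_prod_unfold)
  also have "\<dots> = (\<integral>z. \<integral>x. indicator {..y} z * min x z \<partial>\<mu> \<partial>\<mu>)"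
  proof (rule pair.integral_snd[symmetric])
    have "(\<lambda>(x, z). indicator {..y} z * min x z) \<in> borel_measurable (\<mu> \<Otimes>\<^sub>M \<mu>)"
      by measurable
    then show "integrable (\<mu> \<Otimes>\<^sub>M \<mu>) (\<lambda>(x, z). indicator {..y} z * min x z)"
      by (rule Bochner_Integration.integrable_bound[OF integrable_min_pair]) (auto simp: indicator_def)
  qed
  also have "\<dots> = trunc_mean_below \<mu> y"
    by (simp add: trunc_mean_below_def trunc_mean_def)
  finally show ?thesis by simp
qed

text \<open>The event that \<open>V\<close> lies in \<open>A\<close> belongs to the sigma-algebra
  generated by \<open>V\<close>, so \<open>Z\<close> may be replaced there by its conditional
  expectation \<open>r (V \<omega>)\<close>.\<close>

lemma regression_slab_bounds:
  assumes "prob_space M" and int: "integrable M Z" and V [measurable]: "V \<in> borel_measurable M"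
    and reg: "AE \<omega> in M. real_cond_exp M (vimage_algebra (space M) V borel) Z \<omega> = r (V \<omega>)"
    and A [measurable]: "A \<in> sets borel" and bounds: "\<And>t. t \<in> A \<Longrightarrow> l \<le> r t \<and> r t \<le> u"
  shows "l * measure M (V -` A \<inter> space M) \<le> (\<integral>\<omega>. indicator (V -` A \<inter> space M) \<omega> * Z \<omega> \<partial>M)"
    and "(\<integral>\<omega>. indicator (V -` A \<inter> space M) \<omega> * Z \<omega> \<partial>M) \<le> u * measure M (V -` A \<inter> space M)"
proof -
  interpret prob_space M by fact
  let ?G = "vimage_algebra (space M) V borel" and ?E = "V -` A \<inter> space M"
  have sub: "subalgebra M ?G"
    unfolding subalgebra_def using V by (auto simp: sets_vimage_algebra2 measurable_sets)
  interpret finite_measure_subalgebra M ?G by unfold_locales (rule sub)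
  have E: "?E \<in> sets ?G" by (rule in_vimage_algebra[OF A])
  have EM [measurable]: "?E \<in> sets M" by measurable
  have eq: "(\<integral>\<omega>. indicator ?E \<omega> * Z \<omega> \<partial>M) = (\<integral>\<omega>. indicator ?E \<omega> * real_cond_exp M ?G Z \<omega> \<partial>M)"
    using real_cond_exp_intA[OF int E] by (simp add: set_lebesgue_integral_def)
  have intE: "integrable M (\<lambda>\<omega>. indicator ?E \<omega> * real_cond_exp M ?G Z \<omega>)"
    using integrable_mult_indicator[OF EM real_cond_exp_int(1)[OF int]] by simp
  have intc: "integrable M (\<lambda>\<omega>. indicator ?E \<omega> * c)" for c :: real
    by (intro integrable_mult_left) (simp add: emeasure_eq_measure)
  have ind: "(\<integral>\<omega>. indicator ?E \<omega> * c \<partial>M) = c * measure M ?E" for c :: real by simp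
  show "l * measure M ?E \<le> (\<integral>\<omega>. indicator ?E \<omega> * Z \<omega> \<partial>M)"
    unfolding eq ind[symmetric] using reg
    by (intro integral_mono_AE intE intc) (auto elim!: eventually_mono simp: indicator_def bounds)
  show "(\<integral>\<omega>. indicator ?E \<omega> * Z \<omega> \<partial>M) \<le> u * measure M ?E"
    unfolding eq ind[symmetric] using reg
    by (intro integral_mono_AE intE intc) (auto elim!: eventually_mono simp: indicator_def bounds)
qed

lemma iid_triple_overlap_regression:
  assumes iid: "iid_triple M X \<mu>" and atomless: "\<And>x. measure \<mu> {x} = 0"
    and supp: "interval_support \<mu> a b" and "a < b"
    and int: "integrable M (\<lambda>\<omega>. min (X 1 \<omega>) (X 2 \<omega>))"
    and reg: "continuous_regression M (\<lambda>\<omega>. min (X 1 \<omega>) (X 2 \<omega>)) (\<lambda>\<omega>. max (X 2 \<omega>) (X 3 \<omega>)) a b r"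
  shows "overlap_regression a b r (cdf \<mu>) (trunc_mean \<mu>) (trunc_mean_below \<mu>)"
proof -
  interpret M: prob_space M using iid by (rule iid_tripleD)
  interpret min_integrable_distribution \<mu>
    using iid atomless int by (rule iid_triple_min_integrable_distribution)
  note [measurable] = iid_tripleD(2)[OF iid, of 1, simplified] iid_tripleD(2)[OF iid, of 2, simplified]
    iid_tripleD(2)[OF iid, of 3, simplified]
  let ?V = "\<lambda>\<omega>. max (X 2 \<omega>) (X 3 \<omega>)" and ?Z = "\<lambda>\<omega>. min (X 1 \<omega>) (X 2 \<omega>)"
  let ?L = "\<lambda>y. {\<omega> \<in> space M. ?V \<omega> \<le> y}"
  show ?thesis
  proof (rule overlap_regressionI[OF supp \<open>a < b\<close>])
    show "continuous_on (einterval a b) r" using reg by (simp add: continuous_regression_def)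
    fix y z l u :: real
    assume "y < z" and b: "\<And>t. y < t \<Longrightarrow> t \<le> z \<Longrightarrow> l \<le> r t \<and> r t \<le> u"
    \<comment> \<open>Writing the slab as a difference of two sublevel events makes its probability
      and its partial expectation differences of known functions.\<close>
    have E: "?V -` {y<..z} \<inter> space M = ?L z - ?L y" by auto
    have "measure M (?L z - ?L y) = measure M (?L z) - measure M (?L y)"
      using \<open>y < z\<close> by (intro M.finite_measure_Diff) auto
    then have P: "measure M (?L z - ?L y) = (cdf \<mu> z)\<^sup>2 - (cdf \<mu> y)\<^sup>2"
      by (simp only: iid_triple_measure_max_le[OF iid])
    have intL: "integrable M (\<lambda>\<omega>. indicator (?L t) \<omega> * ?Z \<omega>)" for t
      using integrable_mult_indicator[OF _ int, of "?L t"] by simp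
    have "(\<integral>\<omega>. indicator (?L z - ?L y) \<omega> * ?Z \<omega> \<partial>M)
        = (\<integral>\<omega>. indicator (?L z) \<omega> * ?Z \<omega> - indicator (?L y) \<omega> * ?Z \<omega> \<partial>M)"
      using \<open>y < z\<close> by (intro Bochner_Integration.integral_cong) (auto simp: indicator_def)
    also have "\<dots> = cdf \<mu> z * trunc_mean_below \<mu> z - cdf \<mu> y * trunc_mean_below \<mu> y"
      using iid_triple_expectation_min[OF iid min_integrable_distribution_axioms int]
      by (subst Bochner_Integration.integral_diff[OF intL intL]) simp
    finally have EZ: "(\<integral>\<omega>. indicator (?L z - ?L y) \<omega> * ?Z \<omega> \<partial>M)
      = cdf \<mu> z * trunc_mean_below \<mu> z - cdf \<mu> y * trunc_mean_below \<mu> y" .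
    have "AE \<omega> in M. real_cond_exp M (vimage_algebra (space M) ?V borel) ?Z \<omega> = r (?V \<omega>)"
      using reg by (simp add: continuous_regression_def)
    from regression_slab_bounds[OF M.prob_space_axioms int _ this, of "{y<..z}" l u]
    show "l * ((cdf \<mu> z)\<^sup>2 - (cdf \<mu> y)\<^sup>2) \<le> cdf \<mu> z * trunc_mean_below \<mu> z - cdf \<mu> y * trunc_mean_below \<mu> y \<and>
      cdf \<mu> z * trunc_mean_below \<mu> z - cdf \<mu> y * trunc_mean_below \<mu> y \<le> u * ((cdf \<mu> z)\<^sup>2 - (cdf \<mu> y)\<^sup>2)"
      unfolding E P EZ using b by auto
  qed
qed

theorem regression_min_determines_cdf:
  assumes "a < b"
    and "iid_triple M X \<mu>" "\<And>x. measure \<mu> {x} = 0" and \<mu>: "interval_support \<mu> a b"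
    and "iid_triple N Y \<nu>" "\<And>x. measure \<nu> {x} = 0" and \<nu>: "interval_support \<nu> a b"
    and "integrable M (\<lambda>\<omega>. min (X 1 \<omega>) (X 2 \<omega>))" "integrable N (\<lambda>\<omega>. min (Y 1 \<omega>) (Y 2 \<omega>))"
    and "continuous_regression M (\<lambda>\<omega>. min (X 1 \<omega>) (X 2 \<omega>)) (\<lambda>\<omega>. max (X 2 \<omega>) (X 3 \<omega>)) a b r"
    and "continuous_regression N (\<lambda>\<omega>. min (Y 1 \<omega>) (Y 2 \<omega>)) (\<lambda>\<omega>. max (Y 2 \<omega>) (Y 3 \<omega>)) a b r"
  shows "cdf \<mu> = cdf \<nu>"
proof
  fix x
  \<comment> \<open>Outside the interval both values are prescribed by
    \<open>interval_support\<close>.\<close>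
  consider "ereal x \<le> a" | "b \<le> ereal x" | "x \<in> einterval a b"
    by (force simp: einterval_def)
  then show "cdf \<mu> x = cdf \<nu> x"
  proof cases
    case 3
    show ?thesis
      using assms
      by (intro overlap_regression_unique[OF iid_triple_overlap_regression iid_triple_overlap_regression 3])
  qed (use \<mu> \<nu> in \<open>auto simp: interval_support_def\<close>)
qed

lemma absolutely_continuous_atomless:
  assumes "absolutely_continuous lborel \<mu>" shows "measure \<mu> {x :: real} = 0"
proof -
  have "{x} \<in> null_sets lborel" by (simp add: null_sets_def)
  then have "{x} \<in> null_sets \<mu>" using assms by (auto simp: absolutely_continuous_def)
  then show ?thesis by (simp add: measure_def null_setsD1)
qed

section \<open>Reflection at the origin\<close>

lemma iid_triple_uminus:
  assumes iid: "iid_triple M X \<mu>"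
  shows "iid_triple M (\<lambda>i \<omega>. - X i \<omega>) (distr \<mu> borel uminus)"
proof -
  interpret prob_space M using iid by (rule iid_tripleD)
  have "indep_vars (\<lambda>_. borel) X {1, 2, 3}" using iid by (simp add: iid_triple_def)
  then have "indep_vars (\<lambda>_. borel) (\<lambda>i \<omega>. - X i \<omega>) {1, 2, 3}" by (rule indep_vars_compose2) auto
  moreover have "distr M borel (\<lambda>\<omega>. - X i \<omega>) = distr \<mu> borel uminus" if i: "i \<in> {1, 2, 3}" for i
    using distr_distr[OF borel_measurable_uminus[OF measurable_ident] iid_tripleD(2)[OF iid i]]
      iid_tripleD(3)[OF iid i] by (simp add: comp_def)
  ultimately show ?thesis using prob_space_axioms by (auto simp: iid_triple_def)
qed

context real_distribution
begin

lemma measure_distr_uminus_singleton: "measure (distr M borel uminus) {x} = measure M {- x}"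
proof -
  have "uminus -` {x} = {- x}" by auto
  then show ?thesis by (subst measure_distr) auto
qed

text \<open>Reflection yields the closed half-line from \<open>- x\<close> upwards; without an atom
  at \<open>- x\<close> it has the same mass as the open one.\<close>

lemma cdf_distr_uminus:
  assumes "measure M {- x} = 0"
  shows "cdf (distr M borel uminus) x = 1 - cdf M (- x)"
proof -
  have "cdf (distr M borel uminus) x = measure M {- x..}"
    unfolding cdf_def2 by (subst measure_distr) (auto intro!: arg_cong[where f = "measure M"])
  also have "{- x..} = insert (- x) {- x<..}" by auto
  also have "measure M (insert (- x) {- x<..}) = measure M {- x<..}"
    using assms finite_measure_Union[of "{- x}" "{- x<..}"] by simp
  also have "{- x<..} = UNIV - {..- x}" by auto
  also have "measure M (UNIV - {..- x}) = 1 - cdf M (- x)"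
    using prob_compl[of "{..- x}"] by (simp add: cdf_def2)
  finally show ?thesis .
qed

lemma interval_support_uminus:
  assumes "\<And>x. measure M {x} = 0" "interval_support M a b"
  shows "interval_support (distr M borel uminus) (- b) (- a)"
proof -
  have F: "cdf (distr M borel uminus) x = 1 - cdf M (- x)" for x
    using assms(1) by (rule cdf_distr_uminus)
  have I: "- x \<in> einterval a b" if "x \<in> einterval (- b) (- a)" for x
    using that by (cases a; cases b) (auto simp: einterval_def)
  have "ereal x \<le> - b \<longleftrightarrow> b \<le> ereal (- x)" for x by (cases b) auto
  moreover have "- a \<le> ereal x \<longleftrightarrow> ereal (- x) \<le> a" for x by (cases a) auto
  ultimately show ?thesis
    using assms(2) I unfolding interval_support_def strict_mono_on_def F by auto
qed

end

text \<open>\<open>V\<close> and its negative generate the same sigma-algebra, because reflection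
  preserves the Borel sets; the rest is linearity of conditional expectation.\<close>

lemma continuous_regression_uminus:
  assumes "prob_space M" "integrable M Z" "V \<in> borel_measurable M"
    and reg: "continuous_regression M Z V a b r"
  shows "continuous_regression M (\<lambda>\<omega>. - Z \<omega>) (\<lambda>\<omega>. - V \<omega>) (- b) (- a) (\<lambda>y. - r (- y))"
proof -
  interpret prob_space M by fact
  let ?G = "vimage_algebra (space M) V borel"
  have I: "uminus ` einterval (- b) (- a) \<subseteq> einterval a b"
    by (cases a; cases b) (auto simp: einterval_def)
  have sub: "subalgebra M ?G"
    unfolding subalgebra_def using assms(3) by (auto simp: sets_vimage_algebra2 measurable_sets)
  interpret finite_measure_subalgebra M ?G by unfold_locales (rule sub)
  have "vimage_algebra (space M) (\<lambda>\<omega>. - V \<omega>) borel = vimage_algebra (space M) V (vimage_algebra UNIV uminus (borel :: real measure))"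
    by (subst vimage_algebra_vimage_algebra_eq) auto
  also have "\<dots> = ?G"
  proof (rule vimage_algebra_cong)
    show "sets (vimage_algebra UNIV uminus borel) = sets (borel :: real measure)"
    proof (safe)
      fix A :: "real set" assume "A \<in> sets (vimage_algebra UNIV uminus borel)"
      then obtain B where "B \<in> sets borel" "A = uminus -` B \<inter> UNIV" by (auto simp: sets_vimage_algebra2)
      then show "A \<in> sets borel" using measurable_sets_borel[of uminus borel B] by auto
    next
      fix A :: "real set" assume "A \<in> sets borel"
      then have "uminus -` A \<in> sets borel" using measurable_sets_borel[of uminus borel A] by auto
      moreover have "A = uminus -` (uminus -` A) \<inter> UNIV" by auto
      ultimately show "A \<in> sets (vimage_algebra UNIV uminus borel)"
        by (auto simp: sets_vimage_algebra2)
    qed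
  qed auto
  finally have G: "vimage_algebra (space M) (\<lambda>\<omega>. - V \<omega>) borel = ?G" .
  have "AE \<omega> in M. real_cond_exp M ?G (\<lambda>\<omega>. - Z \<omega>) \<omega> = - real_cond_exp M ?G Z \<omega>"
    using real_cond_exp_cmult[OF assms(2), of "- 1"] by simp
  moreover have "AE \<omega> in M. real_cond_exp M ?G Z \<omega> = r (V \<omega>)"
    using reg by (simp add: continuous_regression_def)
  ultimately have "AE \<omega> in M. real_cond_exp M ?G (\<lambda>\<omega>. - Z \<omega>) \<omega> = - r (- (- V \<omega>))"
    by eventually_elim simp
  moreover have "continuous_on (einterval (- b) (- a)) (\<lambda>y. - r (- y))"
    using reg I unfolding continuous_regression_def
    by (intro continuous_intros continuous_on_compose2[of _ r _ uminus]) auto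
  ultimately show ?thesis unfolding continuous_regression_def G by blast
qed

text \<open>Negating all variables exchanges minima and maxima and maps the interval to
  \<open>(- b, - a)\<close>, so the result for minima applies with the regression function
  \<open>- r (- y)\<close>.\<close>

theorem regression_max_determines_cdf:
  assumes "a < b"
    and M: "iid_triple M X \<mu>" and \<mu>0: "\<And>x. measure \<mu> {x} = 0" and \<mu>: "interval_support \<mu> a b"
    and N: "iid_triple N Y \<nu>" and \<nu>0: "\<And>x. measure \<nu> {x} = 0" and \<nu>: "interval_support \<nu> a b"
    and intM: "integrable M (\<lambda>\<omega>. max (X 1 \<omega>) (X 2 \<omega>))" and intN: "integrable N (\<lambda>\<omega>. max (Y 1 \<omega>) (Y 2 \<omega>))"
    and regM: "continuous_regression M (\<lambda>\<omega>. max (X 1 \<omega>) (X 2 \<omega>)) (\<lambda>\<omega>. min (X 2 \<omega>) (X 3 \<omega>)) a b r"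
    and regN: "continuous_regression N (\<lambda>\<omega>. max (Y 1 \<omega>) (Y 2 \<omega>)) (\<lambda>\<omega>. min (Y 2 \<omega>) (Y 3 \<omega>)) a b r"
  shows "cdf \<mu> = cdf \<nu>"
proof
  fix x
  interpret \<mu>: real_distribution \<mu> using M by (rule iid_tripleD)
  interpret \<nu>: real_distribution \<nu> using N by (rule iid_tripleD)
  have neg: "- max s t = min (- s) (- t)" "- min s t = max (- s) (- t)" for s t :: real by auto
  have "cdf (distr \<mu> borel uminus) = cdf (distr \<nu> borel uminus)"
  proof (rule regression_min_determines_cdf)
    show "- b < - a" using \<open>a < b\<close> by simp
    show "integrable M (\<lambda>\<omega>. min (- X 1 \<omega>) (- X 2 \<omega>))" "integrable N (\<lambda>\<omega>. min (- Y 1 \<omega>) (- Y 2 \<omega>))"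
      using intM intN by (simp_all flip: neg)
    show "continuous_regression M (\<lambda>\<omega>. min (- X 1 \<omega>) (- X 2 \<omega>)) (\<lambda>\<omega>. max (- X 2 \<omega>) (- X 3 \<omega>))
        (- b) (- a) (\<lambda>y. - r (- y))"
      using continuous_regression_uminus[OF iid_tripleD(1)[OF M] intM _ regM] iid_tripleD(2)[OF M]
      by (simp add: neg)
    show "continuous_regression N (\<lambda>\<omega>. min (- Y 1 \<omega>) (- Y 2 \<omega>)) (\<lambda>\<omega>. max (- Y 2 \<omega>) (- Y 3 \<omega>))
        (- b) (- a) (\<lambda>y. - r (- y))"
      using continuous_regression_uminus[OF iid_tripleD(1)[OF N] intN _ regN] iid_tripleD(2)[OF N]
      by (simp add: neg)
  qed (use M N \<mu> \<nu> in \<open>auto intro!: iid_triple_uminus \<mu>.interval_support_uminus \<nu>.interval_support_uminus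
      simp: \<mu>0 \<nu>0 \<mu>.measure_distr_uminus_singleton \<nu>.measure_distr_uminus_singleton\<close>)
  then have "cdf (distr \<mu> borel uminus) (- x) = cdf (distr \<nu> borel uminus) (- x)" by simp
  then show "cdf \<mu> x = cdf \<nu> x"
    by (simp add: \<mu>.cdf_distr_uminus \<nu>.cdf_distr_uminus \<mu>0 \<nu>0)
qed

theorem theorem3p2:
  fixes a b :: ereal
    and \<mu> \<nu> :: "real measure"
    and M :: "'a measure" and X :: "nat \<Rightarrow> 'a \<Rightarrow> real"
    and N :: "'b measure" and Y :: "nat \<Rightarrow> 'b \<Rightarrow> real"
    and r :: "real \<Rightarrow> real"
  assumes "a < b"
    and "iid_triple M X \<mu>" "absolutely_continuous lborel \<mu>" "interval_support \<mu> a b"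
    and "iid_triple N Y \<nu>" "absolutely_continuous lborel \<nu>" "interval_support \<nu> a b"
  shows
    "(integrable M (\<lambda>\<omega>. min (X 1 \<omega>) (X 2 \<omega>)) \<longrightarrow>
      integrable N (\<lambda>\<omega>. min (Y 1 \<omega>) (Y 2 \<omega>)) \<longrightarrow>
      continuous_regression M (\<lambda>\<omega>. min (X 1 \<omega>) (X 2 \<omega>)) (\<lambda>\<omega>. max (X 2 \<omega>) (X 3 \<omega>)) a b r \<longrightarrow>
      continuous_regression N (\<lambda>\<omega>. min (Y 1 \<omega>) (Y 2 \<omega>)) (\<lambda>\<omega>. max (Y 2 \<omega>) (Y 3 \<omega>)) a b r \<longrightarrow>
      (einterval a b \<noteq> UNIV \<longrightarrow> cdf \<mu> = cdf \<nu>) \<and>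
      (einterval a b = UNIV \<longrightarrow> (\<exists>c. \<forall>y. cdf \<nu> y = cdf \<mu> (y + c)))) \<and>
     (integrable M (\<lambda>\<omega>. max (X 1 \<omega>) (X 2 \<omega>)) \<longrightarrow>
      integrable N (\<lambda>\<omega>. max (Y 1 \<omega>) (Y 2 \<omega>)) \<longrightarrow>
      continuous_regression M (\<lambda>\<omega>. max (X 1 \<omega>) (X 2 \<omega>)) (\<lambda>\<omega>. min (X 2 \<omega>) (X 3 \<omega>)) a b r \<longrightarrow>
      continuous_regression N (\<lambda>\<omega>. max (Y 1 \<omega>) (Y 2 \<omega>)) (\<lambda>\<omega>. min (Y 2 \<omega>) (Y 3 \<omega>)) a b r \<longrightarrow>
      (einterval a b \<noteq> UNIV \<longrightarrow> cdf \<mu> = cdf \<nu>) \<and>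
      (einterval a b = UNIV \<longrightarrow> (\<exists>c. \<forall>y. cdf \<nu> y = cdf \<mu> (y + c))))"
proof -
  note atomless = absolutely_continuous_atomless[OF assms(3)] absolutely_continuous_atomless[OF assms(6)]
  \<comment> \<open>On the whole line the shift is witnessed by 0.\<close>
  have equal: "(einterval a b \<noteq> UNIV \<longrightarrow> cdf \<mu> = cdf \<nu>) \<and>
      (einterval a b = UNIV \<longrightarrow> (\<exists>c. \<forall>y. cdf \<nu> y = cdf \<mu> (y + c)))" if "cdf \<mu> = cdf \<nu>"
    using that by (auto intro: exI[of _ 0])
  show ?thesis
    using regression_min_determines_cdf[OF assms(1,2) atomless(1) assms(4,5) atomless(2) assms(7)]
      regression_max_determines_cdf[OF assms(1,2) atomless(1) assms(4,5) atomless(2) assms(7)] equal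
    by blast
qed

end
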